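(* Fix an integer $k\ge 1$. Let $\chi_k^{\ast}(p,q)$ be the formal power series in $p$ satisfying $$1-(m-1)\chi_{k}^{\ast}(p,q)-pq\prod_{j=0}^{k-1}\chi_{k}^{\ast}(pq^j,q)-pq^2\bigl(m(u-1)+1\bigr)\prod_{j=0}^{k}\chi_{k}^{\ast}(pq^j,q)=0 .$$ Then $$\chi_{k}^{\ast}(p,q)=\sum_{n\ge 0}\frac{(-pq)^{n}}{(m-1)^{(k+1)n+1}}\sum_{\mu\in\mathtt{Dyck}(n;k)}\mathrm{wt}^{\ast}(\mu)\,q^{\mathrm{Area}(\mu)},$$ where $\mathrm{Area}(\mu)$ is the number of unit boxes below $\mu$ and above the lowest path $\mu_0=(UD^k)^n$.
   Context: The quantities $m,u,q$ are formal variables with $m-1$ invertible; $m'=m-1$ and $u'=u-1$. A $k$-Dyck path of size $n$ is a lattice path from $(0,0)$ to $(kn,n)$ consisting of up steps $U=(0,1)$ and down steps $D=(1,0)$ which never goes below the line $y=x/k$; $\mathtt{Dyck}(n;k)$ denotes the set of them, and $|\mu|$ denotes the size of $\mu$. The lowest path in $\mathtt{Dyck}(n;k)$ is $\mu_0=(UD^k)^n$. A $k$-Dyck path is prime if it is nonempty and touches the line $y=x/k$ only at its starting and ending points. Every nonempty $k$-Dyck path is uniquely a concatenation $\mu=\mu_1\circ\mu_2$ with $\mu_1$ prime and $\mu_2$ a (possibly empty) $k$-Dyck path. Every prime $k$-Dyck path is uniquely of the form $\mu_1=U\circ\lambda_1\circ D\circ\lambda_2\circ\cdots\circ D\circ\lambda_k\circ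 D$ with $\lambda_1,\ldots,\lambda_k$ (possibly empty) $k$-Dyck paths. The weight $\mathrm{wt}^{\ast}$ is defined recursively: $\mathrm{wt}^{\ast}((UD^k)^n)=(m'+q(m'u'+u'+1))^n$ (in particular $\mathrm{wt}^{\ast}(\emptyset)=1$); $\mathrm{wt}^{\ast}(\mu_1\circ\mu_2)=\mathrm{wt}^{\ast}(\mu_1)\,\mathrm{wt}^{\ast}(\mu_2)$ for $\mu_1$ prime; and for a prime path $\mu_1$ written as $\mu_1=U\circ\lambda_1\circ D\circ\lambda_2\circ\cdots\circ D\circ\lambda_k\circ D$, $$\mathrm{wt}^{\ast}(\mu_1)=\begin{cases} q(m'u'+u'+1)\prod_{i=1}^{k}q^{(k+1-i)|\lambda_i|}\mathrm{wt}^{\ast}(\lambda_i), & \lambda_1\ne\emptyset,\\ (m'+q(m'u'+u'+1))\prod_{i=2}^{k}q^{(k+1-i)|\lambda_i|}\mathrm{wt}^{\ast}(\lambda_i), & \lambda_1=\emptyset.\end{cases}$$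
   Formalization: The weight wt* is taken without the factors q^{(k+1-i)|λ_i|} in its recursion for prime paths; with them the area is counted twice and the identity already fails for k=1 at p^2 (path UUDD). *)

theory Defs
  imports "HOL-Computational_Algebra.Formal_Power_Series"
begin

datatype step = U | D

abbreviation xpos :: "step list \<Rightarrow> nat" where "xpos \<mu> \<equiv> count_list \<mu> D"
abbreviation ypos :: "step list \<Rightarrow> nat" where "ypos \<mu> \<equiv> count_list \<mu> U"

text \<open>
  A path starts at the origin and is visited at the points
  \<open>(xpos (take i \<mu>), ypos (take i \<mu>))\<close>. All segments run between lattice points, so a path
  stays weakly above the line \<open>y = x/k\<close> iff its lattice points do, and (for a path that
  stays above) it meets the line only in lattice points.
\<close>

definition dyck :: "nat \<Rightarrow> nat \<Rightarrow> step list set" where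
  "dyck n k = {\<mu>. xpos \<mu> = k * n \<and> ypos \<mu> = n \<and>
                  (\<forall>i \<le> length \<mu>. xpos (take i \<mu>) \<le> k * ypos (take i \<mu>))}"

definition is_dyck :: "nat \<Rightarrow> step list \<Rightarrow> bool" where
  "is_dyck k \<mu> \<longleftrightarrow> (\<exists>n. \<mu> \<in> dyck n k)"

definition prime_dyck :: "nat \<Rightarrow> step list \<Rightarrow> bool" where
  "prime_dyck k \<mu> \<longleftrightarrow> is_dyck k \<mu> \<and> \<mu> \<noteq> [] \<and>
     (\<forall>i. 0 < i \<and> i < length \<mu> \<longrightarrow> xpos (take i \<mu>) \<noteq> k * ypos (take i \<mu>))"

definition lowest :: "nat \<Rightarrow> nat \<Rightarrow> step list" where
  "lowest n k = concat (replicate n (U # replicate k D))"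

text \<open>
  The pair \<open>(a, b)\<close> stands for the unit box with lower left corner \<open>(a, b)\<close>. It is below
  (above) a path iff the unique horizontal step of the path in column \<open>a\<close> has height at least
  \<open>b + 1\<close> (at most \<open>b\<close>).
\<close>

definition box_below :: "step list \<Rightarrow> nat \<times> nat \<Rightarrow> bool" where
  "box_below \<mu> = (\<lambda>(a, b). \<exists>i < length \<mu>. \<mu> ! i = D \<and> xpos (take i \<mu>) = a \<and> b + 1 \<le> ypos (take i \<mu>))"

definition box_above :: "step list \<Rightarrow> nat \<times> nat \<Rightarrow> bool" where
  "box_above \<mu> = (\<lambda>(a, b). \<exists>i < length \<mu>. \<mu> ! i = D \<and> xpos (take i \<mu>) = a \<and> ypos (take i \<mu>) \<le> b)"

definition area :: "nat \<Rightarrow> step list \<Rightarrow> nat" where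
  "area k \<mu> = card {B. box_below \<mu> B \<and> box_above (lowest (ypos \<mu>) k) B}"

definition join :: "step list list \<Rightarrow> step list" where
  "join ls = concat (map (\<lambda>l. l @ [D]) ls)"

text \<open>
  \<open>cut_at k h xs = (l, r)\<close> with \<open>xs = l @ D # r\<close>, where this \<open>D\<close> is the first step leading from
  height \<open>h\<close> (up steps count \<open>k\<close>, down steps count \<open>-1\<close>) to height \<open>-1\<close>. Iterating it,
  \<open>split_path k i xs = ([l\<^sub>1, \<dots>, l\<^sub>i], r)\<close> with \<open>xs = l\<^sub>1 @ D # \<dots> @ l\<^sub>i @ D # r\<close>. Thus a nonempty
  path is decomposed in one go as \<open>U \<circ> \<lambda>\<^sub>1 \<circ> D \<circ> \<dots> \<circ> \<lambda>\<^sub>k \<circ> D \<circ> \<mu>\<^sub>2\<close>, that is, into its first prime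
  factor together with the \<open>\<lambda>\<^sub>i\<close>, and the remaining path.
\<close>

fun cut_at :: "nat \<Rightarrow> nat \<Rightarrow> step list \<Rightarrow> step list \<times> step list" where
  "cut_at k h [] = ([], [])"
| "cut_at k h (U # xs) = (let (l, r) = cut_at k (h + k) xs in (U # l, r))"
| "cut_at k 0 (D # xs) = ([], xs)"
| "cut_at k (Suc h) (D # xs) = (let (l, r) = cut_at k h xs in (D # l, r))"

fun split_path :: "nat \<Rightarrow> nat \<Rightarrow> step list \<Rightarrow> step list list \<times> step list" where
  "split_path k 0 xs = ([], xs)"
| "split_path k (Suc i) xs =
     (let (l, r) = cut_at k 0 xs; (ls, r') = split_path k i r in (l # ls, r'))"

lemma cut_at_length: "length (fst (cut_at k h xs)) + length (snd (cut_at k h xs)) \<le> length xs"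
  by (induction k h xs rule: cut_at.induct) (auto split: prod.splits)

lemma split_path_length:
  "(\<forall>l \<in> set (fst (split_path k i xs)). length l \<le> length xs) \<and>
   length (snd (split_path k i xs)) \<le> length xs"
proof (induction i arbitrary: xs)
  case (Suc i)
  obtain l r where lr: "cut_at k 0 xs = (l, r)" by fastforce
  obtain ls r' where lsr: "split_path k i r = (ls, r')" by fastforce
  show ?case
    using Suc[of r] cut_at_length[of k 0 xs] lr lsr by (fastforce dest: order_trans)
qed simp

text \<open>
  The weight \<open>wt\<^sup>*\<close>, by recursion on the decomposition above; its values on lists that are not
  Dyck paths are irrelevant. The defining recursion of \<open>wt\<^sup>*\<close> in terms of prime factors is
  recovered below as \<open>wt_star_lowest\<close>, \<open>wt_star_append\<close> and \<open>wt_star_prime\<close>.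

  Pitfall: \<open>wt\<^sup>*\<close> carries no factors \<open>q ^ ((k + 1 - i) * |\<lambda>\<^sub>i|)\<close>. Lifting \<open>\<lambda>\<^sub>i\<close> inside a prime path
  adds \<open>(k + 1 - i) * |\<lambda>\<^sub>i|\<close> boxes, so these powers of \<open>q\<close> are part of \<open>q ^ area k \<mu>\<close>. Putting them
  into the weight too counts the area twice, and the functional equation then fails, first for
  \<open>k = 1\<close> and the path \<open>UUDD\<close>.
\<close>

function wt_star :: "nat \<Rightarrow> 'a::comm_ring_1 \<Rightarrow> 'a \<Rightarrow> 'a \<Rightarrow> step list \<Rightarrow> 'a" where
  "wt_star k m u q [] = 1"
| "wt_star k m u q (D # xs) = 0"
| "wt_star k m u q (U # xs) =
     (let m' = m - 1; u' = u - 1; ls = fst (split_path k k xs); \<mu>2 = snd (split_path k k xs)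
      in (if hd ls \<noteq> []
          then q * (m' * u' + u' + 1) * prod_list (map (wt_star k m u q) ls)
          else (m' + q * (m' * u' + u' + 1)) * prod_list (map (wt_star k m u q) (tl ls)))
         * wt_star k m u q \<mu>2)"
  by pat_completeness auto
termination
proof (relation "measure (\<lambda>(k, m, u, q, xs). length xs)", goal_cases)
  case (3 k m u q xs x xa xb xc xd)
  then show ?case using split_path_length[of k k xs]
    by (cases "fst (split_path k k xs)") (auto simp: less_Suc_eq_le)
qed (use split_path_length in \<open>auto simp: less_Suc_eq_le\<close>)


lemma finite_dyck: "finite (dyck n k)"
proof -
  have len: "length xs = ypos xs + xpos xs" for xs :: "step list"
  proof (induction xs)
    case (Cons a xs)
    then show ?case by (cases a) auto
  qed simp
  have "s \<in> {U, D}" for s by (cases s) auto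
  hence "dyck n k \<subseteq> {xs. set xs \<subseteq> {U, D} \<and> length xs = n + k * n}"
    using len by (auto simp: dyck_def)
  thus ?thesis using finite_lists_length_eq[of "{U, D}"] finite_subset by blast
qed

lemma is_dyck_iff:
  "is_dyck k \<mu> \<longleftrightarrow> xpos \<mu> = k * ypos \<mu> \<and> (\<forall>i \<le> length \<mu>. xpos (take i \<mu>) \<le> k * ypos (take i \<mu>))"
  by (auto simp: is_dyck_def dyck_def)

lemma cut_at_append:
  assumes "\<forall>i \<le> length l. xpos (take i l) \<le> h + k * ypos (take i l)" "xpos l = h + k * ypos l"
  shows "cut_at k h (l @ D # r) = (l, r)"
  using assms
proof (induction l arbitrary: h)
  case Nil
  then show ?case by simp
next
  case (Cons a l)
  have pre: "xpos (a # take i l) \<le> h + k * ypos (a # take i l)" if "i \<le> length l" for i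
    using Cons.prems(1) that by (metis Suc_le_mono length_Cons take_Suc_Cons)
  show ?case
  proof (cases a)
    case U
    have "cut_at k (h + k) (l @ D # r) = (l, r)"
      using Cons.prems(2) pre U by (intro Cons.IH) (auto simp: algebra_simps)
    then show ?thesis using U by simp
  next
    case D
    with pre[of 0] obtain h' where h: "h = Suc h'" by (cases h) auto
    have "cut_at k h' (l @ step.D # r) = (l, r)"
      using Cons.prems(2) pre D h by (intro Cons.IH) auto
    then show ?thesis using D h by simp
  qed
qed

lemma split_path_join:
  assumes "\<forall>l \<in> set ls. is_dyck k l"
  shows "split_path k (length ls) (join ls @ r) = (ls, r)"
  using assms
proof (induction ls)
  case (Cons l ls)
  have "cut_at k 0 (l @ D # (join ls @ r)) = (l, join ls @ r)"
    using Cons.prems by (intro cut_at_append) (auto simp: is_dyck_iff)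
  then show ?case using Cons by (simp add: join_def)
qed (simp add: join_def)

lemma cut_at_exists:
  assumes "h + k * ypos xs < xpos xs"
  shows "\<exists>l r. xs = l @ D # r \<and> xpos l = h + k * ypos l \<and>
               (\<forall>i \<le> length l. xpos (take i l) \<le> h + k * ypos (take i l))"
  using assms
proof (induction xs arbitrary: h)
  case (Cons a xs)
  show ?case
  proof (cases a)
    case U
    then obtain l r where lr: "xs = l @ D # r" "xpos l = h + k + k * ypos l"
      "\<forall>i \<le> length l. xpos (take i l) \<le> h + k + k * ypos (take i l)"
      using Cons.IH[of "h + k"] Cons.prems by (auto simp: algebra_simps)
    have "xpos (take i (U # l)) \<le> h + k * ypos (take i (U # l))" if "i \<le> length (U # l)" for i
      using lr(3) that by (cases i) (auto simp: algebra_simps)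
    then show ?thesis using lr U by (intro exI[of _ "U # l"] exI[of _ r]) auto
  next
    case D
    show ?thesis
    proof (cases h)
      case 0
      then show ?thesis using D by (intro exI[of _ "[]"] exI[of _ xs]) auto
    next
      case (Suc h')
      then obtain l r where lr: "xs = l @ step.D # r" "xpos l = h' + k * ypos l"
        "\<forall>i \<le> length l. xpos (take i l) \<le> h' + k * ypos (take i l)"
        using Cons.IH[of h'] Cons.prems D by auto
      have "xpos (take i (step.D # l)) \<le> h + k * ypos (take i (step.D # l))"
        if "i \<le> length (step.D # l)" for i
        using lr(3) that Suc by (cases i) auto
      then show ?thesis using lr D Suc by (intro exI[of _ "step.D # l"] exI[of _ r]) auto
    qed
  qed
qed simp

lemma join_exists:
  assumes "xpos xs = i + k * ypos xs" "\<forall>j < length xs. xpos (take j xs) < i + k * ypos (take j xs)"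
  shows "\<exists>ls. length ls = i \<and> (\<forall>l \<in> set ls. is_dyck k l) \<and> xs = join ls"
  using assms
proof (induction i arbitrary: xs)
  case 0
  have "xs = []" using 0(2)[rule_format, of 0] by (cases xs) auto
  then show ?case by (simp add: join_def)
next
  case (Suc i)
  obtain l r where lr: "xs = l @ D # r" "xpos l = k * ypos l"
    "\<forall>j \<le> length l. xpos (take j l) \<le> k * ypos (take j l)"
    using cut_at_exists[of 0 k xs] Suc.prems(1) by auto
  have "\<exists>ls. length ls = i \<and> (\<forall>l \<in> set ls. is_dyck k l) \<and> r = join ls"
  proof (rule Suc.IH)
    show "xpos r = i + k * ypos r" using Suc.prems(1) lr by (simp add: algebra_simps)
    show "\<forall>j < length r. xpos (take j r) < i + k * ypos (take j r)"
    proof (intro allI impI)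
      fix j assume "j < length r"
      then show "xpos (take j r) < i + k * ypos (take j r)"
        using Suc.prems(2)[rule_format, of "length l + Suc j"] lr by (simp add: algebra_simps)
    qed
  qed
  then obtain ls where "length ls = i" "\<forall>l \<in> set ls. is_dyck k l" "r = join ls" by blast
  with lr show ?case by (intro exI[of _ "l # ls"]) (auto simp: join_def is_dyck_iff)
qed

lemma prime_dyck_decomp:
  assumes "prime_dyck k \<mu>"
  shows "\<exists>ls. length ls = k \<and> (\<forall>l \<in> set ls. is_dyck k l) \<and> \<mu> = U # join ls"
proof -
  from assms obtain a xs where \<mu>: "\<mu> = a # xs" by (cases \<mu>) (auto simp: prime_dyck_def)
  have "a = U"
  proof (cases a)
    case D
    with assms \<mu> show ?thesis by (auto simp: prime_dyck_def is_dyck_iff dest: spec[of _ 1])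
  qed
  have "xpos xs = k + k * ypos xs" using assms \<mu> \<open>a = U\<close> by (simp add: prime_dyck_def is_dyck_iff)
  moreover have "xpos (take j xs) < k + k * ypos (take j xs)" if "j < length xs" for j
  proof -
    have "xpos (take (Suc j) \<mu>) \<le> k * ypos (take (Suc j) \<mu>)"
      "xpos (take (Suc j) \<mu>) \<noteq> k * ypos (take (Suc j) \<mu>)"
      using assms that \<mu> by (auto simp: prime_dyck_def is_dyck_iff simp del: take_Suc_Cons)
    then show ?thesis using \<mu> \<open>a = U\<close> by simp
  qed
  ultimately show ?thesis using join_exists \<mu> \<open>a = U\<close> by blast
qed

lemma wt_star_prime:
  assumes "length ls = k" "\<forall>l \<in> set ls. is_dyck k l"
  shows "wt_star k m u q (U # join ls) =
    (let m' = m - 1; u' = u - 1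
     in if hd ls \<noteq> [] then q * (m' * u' + u' + 1) * (\<Prod>l\<leftarrow>ls. wt_star k m u q l)
        else (m' + q * (m' * u' + u' + 1)) * (\<Prod>l\<leftarrow>tl ls. wt_star k m u q l))"
  using split_path_join[of ls k "[]"] assms by (simp add: Let_def)

lemma wt_star_append:
  assumes "prime_dyck k \<mu>1"
  shows "wt_star k m u q (\<mu>1 @ \<mu>2) = wt_star k m u q \<mu>1 * wt_star k m u q \<mu>2"
proof -
  obtain ls where ls: "length ls = k" "\<forall>l \<in> set ls. is_dyck k l" "\<mu>1 = U # join ls"
    using prime_dyck_decomp[OF assms] by blast
  then show ?thesis
    using split_path_join[of ls k \<mu>2] split_path_join[of ls k "[]"] by (simp add: Let_def)
qed

lemma wt_star_lowest:
  assumes "k \<ge> 1"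
  shows "wt_star k m u q (lowest n k) = ((m - 1) + q * ((m - 1) * (u - 1) + (u - 1) + 1)) ^ n"
proof (induction n)
  case (Suc n)
  define ls :: "step list list" where "ls = replicate k []"
  have "join ls = replicate k D" unfolding ls_def by (induction k) (auto simp: join_def)
  moreover have "is_dyck k []" by (simp add: is_dyck_iff)
  ultimately have "split_path k k (replicate k D @ r) = (ls, r)" for r
    using split_path_join[of ls k r] by (simp add: ls_def)
  moreover have "hd ls = []" using assms by (cases k) (auto simp: ls_def)
  moreover have "prod_list (map (wt_star k m u q) (tl ls)) = 1"
    by (cases k) (auto simp: ls_def map_replicate_const prod_list_replicate)
  ultimately show ?case using Suc by (simp add: lowest_def Let_def)
qed (simp add: lowest_def)

end

(*
  Let W(p) be the generating function of Dyck paths by wt* and area. Cutting a nonempty path as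
  U l_1 D ... l_k D mu, the lift of l_i adds (k + 1 - i)|l_i| boxes, so l_i contributes the factor
  W(p q^(k+1-i)); an empty l_1 contributes the extra summand m - 1 of wt*. Hence
    W(p) = 1 + p ((m - 1) prod_{j<k} W(p q^j) + q (m (u - 1) + 1) prod_{j<=k} W(p q^j)),
  and chi(p) = W(-p q / (m - 1)^(k+1)) / (m - 1) turns this into the given equation. That equation
  determines its solution coefficient by coefficient, because m - 1 is invertible.

  The area is computed from the sum of the heights of all down steps, which exceeds it by
  k n (n + 1) / 2 and behaves well under concatenation.
*)
theory Submission
  imports Defs
begin

unbundle fps_syntax

section \<open>Heights of the down steps and the area\<close>

text \<open>Entry \<open>a\<close> is the height of the path over column \<open>a\<close>; the
  starting height \<open>h\<close> lets the list of a concatenation be read off its pieces.\<close>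

fun down_heights :: "nat \<Rightarrow> step list \<Rightarrow> nat list" where
  "down_heights h [] = []"
| "down_heights h (U # xs) = down_heights (Suc h) xs"
| "down_heights h (D # xs) = h # down_heights h xs"

lemma length_down_heights: "length (down_heights h xs) = xpos xs"
  by (induction h xs rule: down_heights.induct) auto

lemma down_heights_append:
  "down_heights h (xs @ ys) = down_heights h xs @ down_heights (h + ypos xs) ys"
  by (induction h xs rule: down_heights.induct) auto

lemma sum_down_heights_shift:
  "sum_list (down_heights h xs) = sum_list (down_heights 0 xs) + h * xpos xs"
proof (induction xs arbitrary: h)
  case (Cons s xs)
  show ?case
    by (cases s) (simp_all add: Cons[of h] Cons[of "Suc h"] Cons[of "Suc 0"])
qed simp

text \<open>Each column contains exactly one down step, so the search for it is a lookup.
  \<open>P\<close> stays free to serve boxes below, boxes above and the recovery of the step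
  itself.\<close>

lemma down_step_iff:
  "(\<exists>i < length xs. xs ! i = D \<and> xpos (take i xs) = a \<and> P (h + ypos (take i xs)))
   \<longleftrightarrow> a < xpos xs \<and> P (down_heights h xs ! a)"
proof (induction xs arbitrary: h a)
  case (Cons s xs)
  have split: "(\<exists>i < length (s # xs). Q i) \<longleftrightarrow> Q 0 \<or> (\<exists>i < length xs. Q (Suc i))" for Q
    by (simp add: Ex_less_Suc2)
  show ?case
  proof (cases s)
    case U
    then show ?thesis using Cons[of a "Suc h"] unfolding split by simp
  next
    case D
    then show ?thesis using Cons[of "a - 1" h] unfolding split by (cases a) auto
  qed
qed simp

lemma box_below_iff: "box_below \<mu> (a, b) \<longleftrightarrow> a < xpos \<mu> \<and> b < down_heights 0 \<mu> ! a"
  using down_step_iff[of \<mu> a "\<lambda>y. b + 1 \<le> y" 0] by (auto simp: box_below_def)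

lemma box_above_iff: "box_above \<mu> (a, b) \<longleftrightarrow> a < xpos \<mu> \<and> down_heights 0 \<mu> ! a \<le> b"
  using down_step_iff[of \<mu> a "\<lambda>y. y \<le> b" 0] by (auto simp: box_above_def)

lemma down_heights_replicate_D: "down_heights h (replicate k D) = replicate k h"
  by (induction k) auto

lemma count_replicate_D: "xpos (replicate k D) = k" "ypos (replicate k D) = 0"
  by (induction k) auto

lemma xpos_lowest: "xpos (lowest n k) = k * n"
  by (induction n) (auto simp: lowest_def count_replicate_D)

lemma down_heights_lowest_Suc:
  "down_heights h (lowest (Suc n) k) = replicate k (Suc h) @ down_heights (Suc h) (lowest n k)"
  by (simp add: lowest_def down_heights_append down_heights_replicate_D count_replicate_D)

lemma nth_down_heights_lowest:
  "a < k * n \<Longrightarrow> down_heights h (lowest n k) ! a = h + a div k + 1"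
proof (induction n arbitrary: h a)
  case (Suc n)
  show ?case
  proof (cases "a < k")
    case False
    then have "a - k < k * n" "a div k = Suc ((a - k) div k)"
      using Suc.prems by (cases "k = 0"; simp add: le_div_geq)+
    then show ?thesis using False Suc.IH by (simp add: down_heights_lowest_Suc nth_append)
  qed (simp add: down_heights_lowest_Suc nth_append)
qed simp

text \<open>Doubling avoids halving \<open>n * (n + 1)\<close>; \<open>h\<close> varies because
  removing the first block raises the start by one.\<close>

lemma sum_down_heights_lowest:
  "2 * sum_list (down_heights h (lowest n k)) = 2 * h * k * n + k * n * (n + 1)"
proof (induction n arbitrary: h)
  case (Suc n)
  show ?case
    using Suc[of "Suc h"]
    by (simp add: down_heights_lowest_Suc sum_list_replicate algebra_simps)
qed (simp add: lowest_def)

text \<open>The Dyck condition is applied just after the down step in column \<open>a\<close>; just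
  before it, the bound would be too weak for the \<open>+ 1\<close>.\<close>

lemma down_heights_dyck_ge:
  assumes "\<mu> \<in> dyck n k" "a < k * n"
  shows "a div k + 1 \<le> down_heights 0 \<mu> ! a"
proof -
  have "a < xpos \<mu>" using assms by (simp add: dyck_def)
  then obtain i where i: "i < length \<mu>" "\<mu> ! i = D" "xpos (take i \<mu>) = a"
      "ypos (take i \<mu>) = down_heights 0 \<mu> ! a"
    using down_step_iff[of \<mu> a "\<lambda>y. y = down_heights 0 \<mu> ! a" 0] by auto
  have "xpos (take (Suc i) \<mu>) \<le> k * ypos (take (Suc i) \<mu>)"
    using assms i(1) by (auto simp: dyck_def)
  then have "a < k * down_heights 0 \<mu> ! a"
    using i by (simp add: take_Suc_conv_app_nth)
  then show ?thesis
    by (metis Suc_eq_plus1 Suc_leI less_mult_imp_div_less mult.commute)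
qed

text \<open>Each column contributes the difference of the two heights, and the pointwise comparison
  with the lowest path makes the truncated subtraction exact.\<close>

lemma area_dyck:
  assumes "\<mu> \<in> dyck n k"
  shows "2 * area k \<mu> + k * n * (n + 1) = 2 * sum_list (down_heights 0 \<mu>)"
proof -
  let ?d = "down_heights 0 \<mu>" and ?l = "down_heights 0 (lowest n k)"
  have n: "xpos \<mu> = k * n" "ypos \<mu> = n" using assms by (auto simp: dyck_def)
  have le: "?l ! a \<le> ?d ! a" if "a < k * n" for a
    using nth_down_heights_lowest[OF that, of 0] down_heights_dyck_ge[OF assms that] by simp
  have "{B. box_below \<mu> B \<and> box_above (lowest (ypos \<mu>) k) B}
          = (SIGMA a:{..<k * n}. {?l ! a..<?d ! a})"
    by (auto simp: box_below_iff box_above_iff n xpos_lowest)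
  then have "area k \<mu> = (\<Sum>a<k * n. ?d ! a - ?l ! a)"
    by (simp add: area_def)
  then have "area k \<mu> + (\<Sum>a<k * n. ?l ! a) = (\<Sum>a<k * n. ?d ! a)"
    using le by (simp flip: sum.distrib)
  then have "area k \<mu> + sum_list ?l = sum_list ?d"
    by (simp add: sum_list_sum_nth length_down_heights xpos_lowest n lessThan_atLeast0)
  then show ?thesis using sum_down_heights_lowest[of 0 n k] by simp
qed

text \<open>
  The area inside the prime path \<open>U # join ls\<close>. The lift \<open>k + 1 - i\<close> of \<open>\<lambda>\<^sub>i\<close> is counted from the right end
  of \<open>ls\<close>, so that it does not change when a path is added in front.
\<close>

fun join_area :: "nat \<Rightarrow> step list list \<Rightarrow> nat" where
  "join_area k [] = 0"
| "join_area k (l # ls) = area k l + Suc (length ls) * ypos l + join_area k ls"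

lemma is_dyck_mem: "is_dyck k \<mu> \<longleftrightarrow> \<mu> \<in> dyck (ypos \<mu>) k"
  by (auto simp: is_dyck_def dyck_def)

lemma join_simps [simp]: "join [] = []" "join (l # ls) = l @ D # join ls"
  by (auto simp: join_def)

lemma ypos_join: "ypos (join ls) = sum_list (map ypos ls)"
  by (induction ls) auto

lemma xpos_join:
  "\<forall>l \<in> set ls. is_dyck k l \<Longrightarrow> xpos (join ls) = length ls + k * sum_list (map ypos ls)"
  by (induction ls) (auto simp: is_dyck_iff algebra_simps)

text \<open>The term \<open>Suc (length ls) * ypos l\<close> of \<open>join_area\<close> comes from
  the separators after \<open>l\<close>, each raised by \<open>ypos l\<close>. The other down steps
  behind \<open>l\<close> give the cross term that completes \<open>k * N * (N + 1)\<close>.\<close>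

lemma sum_down_heights_join:
  assumes "\<forall>l \<in> set ls. is_dyck k l" "N = sum_list (map ypos ls)"
  shows "2 * sum_list (down_heights h (join ls))
    = 2 * join_area k ls + k * N * (N + 1) + 2 * h * k * N + 2 * length ls * h"
  using assms
proof (induction ls arbitrary: h N)
  case (Cons l ls)
  define M where "M = sum_list (map ypos ls)"
  have l: "2 * area k l + k * ypos l * (ypos l + 1) = 2 * sum_list (down_heights 0 l)"
    "xpos l = k * ypos l"
    using Cons.prems(1) area_dyck[of l "ypos l" k] is_dyck_mem[of k l] is_dyck_iff[of k l] by auto
  have "2 * sum_list (down_heights h (join (l # ls)))
      = 2 * sum_list (down_heights 0 l) + 2 * h * xpos l + 2 * (h + ypos l)
        + 2 * sum_list (down_heights (h + ypos l) (join ls))"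
    by (simp add: down_heights_append sum_down_heights_shift[of h l])
  also have "2 * sum_list (down_heights (h + ypos l) (join ls))
      = 2 * join_area k ls + k * M * (M + 1) + 2 * (h + ypos l) * k * M
        + 2 * length ls * (h + ypos l)"
    using Cons by (simp add: M_def)
  finally show ?case
    unfolding l(1)[symmetric] l(2) using Cons.prems(2)
    by (simp add: M_def[symmetric] algebra_simps)
qed simp

section \<open>Cutting a path into its first prime factor and the rest\<close>

text \<open>With up steps worth \<open>k\<close> and down steps worth -1, this is a path that starts
  at height \<open>h\<close> and never drops below 0; a Dyck path is one from 0 to 0.\<close>

definition walk :: "nat \<Rightarrow> nat \<Rightarrow> step list \<Rightarrow> bool" where
  "walk k h xs \<longleftrightarrow> (\<forall>i \<le> length xs. xpos (take i xs) \<le> h + k * ypos (take i xs))"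

lemma walk_append:
  assumes "walk k h xs" "h + k * ypos xs = xpos xs + h'" "walk k h' ys"
  shows "walk k h (xs @ ys)"
  unfolding walk_def
proof (intro allI impI)
  fix i assume i: "i \<le> length (xs @ ys)"
  show "xpos (take i (xs @ ys)) \<le> h + k * ypos (take i (xs @ ys))"
  proof (cases "i \<le> length xs")
    case True
    then show ?thesis using assms(1) by (simp add: walk_def)
  next
    case False
    then have "xpos (take (i - length xs) ys) \<le> h' + k * ypos (take (i - length xs) ys)"
      using assms(3) i by (simp add: walk_def)
    then show ?thesis using False assms(2) by (simp add: algebra_simps)
  qed
qed

lemma walk_appendD:
  assumes "walk k h (xs @ ys)" "h + k * ypos xs = xpos xs + h'"
  shows "walk k h' ys"
  unfolding walk_def
proof (intro allI impI)
  fix i assume "i \<le> length ys"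
  then show "xpos (take i ys) \<le> h' + k * ypos (take i ys)"
    using assms(1)[unfolded walk_def, rule_format, of "length xs + i"] assms(2)
    by (simp add: algebra_simps)
qed

lemma walk_mono: "walk k h xs \<Longrightarrow> h \<le> h' \<Longrightarrow> walk k h' xs"
  unfolding walk_def by (meson add_le_mono1 le_trans)

lemma is_dyck_walk: "is_dyck k \<mu> \<longleftrightarrow> xpos \<mu> = k * ypos \<mu> \<and> walk k 0 \<mu>"
  by (simp add: is_dyck_iff walk_def)

lemma walk_U: "walk k 0 [U]"
  by (auto simp: walk_def le_Suc_eq)

lemma walk_D: "0 < h \<Longrightarrow> walk k h [D]"
  by (auto simp: walk_def le_Suc_eq)

lemma walk_join:
  "\<forall>l \<in> set ls. is_dyck k l \<Longrightarrow> walk k (length ls) (join ls)"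
proof (induction ls)
  case (Cons l ls)
  then have "walk k (Suc (length ls)) ([D] @ join ls)"
    by (intro walk_append[OF walk_D, where h' = "length ls"]) auto
  moreover have "walk k (Suc (length ls)) l" "xpos l = k * ypos l"
    using Cons.prems walk_mono[of k 0 l] by (auto simp: is_dyck_walk)
  ultimately have "walk k (Suc (length ls)) (l @ [D] @ join ls)"
    by (metis walk_append add.commute)
  then show ?case by simp
qed (simp add: walk_def)

lemma is_dyck_U_join:
  assumes "\<forall>l \<in> set ls. is_dyck k l" "length ls = k" "is_dyck k \<mu>"
  shows "is_dyck k (U # join ls @ \<mu>)"
proof -
  have "walk k k (join ls @ \<mu>)"
    using assms walk_join[OF assms(1)] xpos_join[OF assms(1)]
    by (intro walk_append[where h' = 0]) (auto simp: is_dyck_walk ypos_join)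
  then have "walk k 0 ([U] @ join ls @ \<mu>)"
    by (intro walk_append[OF walk_U]) auto
  then show ?thesis
    using assms xpos_join[OF assms(1)]
    by (auto simp: is_dyck_walk ypos_join algebra_simps)
qed

text \<open>Each cut is at the first step below the current starting level, so a Dyck path precedes
  it. Unlike in \<open>join_exists\<close>, height 0 may be reached early; what follows the
  \<open>i\<close>-th cut is \<open>r\<close>.\<close>

lemma join_append_exists:
  assumes "xpos xs = i + k * ypos xs" "walk k i xs"
  shows "\<exists>ls r. length ls = i \<and> (\<forall>l \<in> set ls. is_dyck k l) \<and> is_dyck k r \<and> xs = join ls @ r"
  using assms
proof (induction i arbitrary: xs)
  case 0
  then show ?case by (intro exI[of _ "[]"] exI[of _ xs]) (auto simp: is_dyck_walk)
next
  case (Suc i)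
  obtain l r where lr: "xs = l @ D # r" "xpos l = k * ypos l" "walk k 0 l"
    using cut_at_exists[of 0 k xs] Suc.prems(1) by (auto simp: walk_def)
  have "walk k i r"
    using Suc.prems(2) lr by (intro walk_appendD[of k "Suc i" "l @ [D]" r]) auto
  then obtain ls r' where "length ls = i" "\<forall>l \<in> set ls. is_dyck k l" "is_dyck k r'"
      "r = join ls @ r'"
    using Suc.IH[of r] Suc.prems(1) lr by (auto simp: algebra_simps)
  with lr show ?case
    by (intro exI[of _ "l # ls"] exI[of _ r']) (auto simp: is_dyck_walk)
qed

text \<open>The initial \<open>U\<close> leads to height \<open>k\<close>, and \<open>k\<close> cuts
  bring the path back to the line.\<close>

lemma dyck_decomp:
  assumes "\<mu> \<in> dyck (Suc n) k"
  shows "\<exists>ls r. length ls = k \<and> (\<forall>l \<in> set ls. is_dyck k l) \<and> is_dyck k r \<and> \<mu> = U # join ls @ r"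
proof -
  have \<mu>: "xpos \<mu> = k * ypos \<mu>" "walk k 0 \<mu>" "ypos \<mu> = Suc n"
    using assms by (auto simp: dyck_def walk_def)
  then obtain s xs where s: "\<mu> = s # xs" by (cases \<mu>) auto
  have "s = U"
  proof (cases s)
    case D
    then show ?thesis using \<mu>(2) s by (auto simp: walk_def dest: spec[of _ 1])
  qed
  have "walk k k xs"
    using walk_appendD[of k 0 "[U]" xs k] \<mu>(2) s \<open>s = U\<close> by simp
  then show ?thesis
    using join_append_exists[of xs k k] \<mu>(1) s \<open>s = U\<close> by auto
qed

section \<open>Summation over decompositions\<close>

text \<open>The length \<open>i\<close> is kept apart from \<open>k\<close> for induction, and
  because an empty first path leaves \<open>k - 1\<close> paths to sum over.\<close>

definition dyck_tuples :: "nat \<Rightarrow> nat \<Rightarrow> nat \<Rightarrow> step list list set" where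
  "dyck_tuples k i n =
     {ls. length ls = i \<and> (\<forall>l \<in> set ls. is_dyck k l) \<and> sum_list (map ypos ls) = n}"

lemma dyck_tuples_0: "dyck_tuples k 0 n = (if n = 0 then {[]} else {})"
  by (auto simp: dyck_tuples_def)

lemma dyck_tuples_Suc:
  "dyck_tuples k (Suc i) n =
     (\<lambda>(a, l, ls). l # ls) ` (SIGMA a:{..n}. dyck a k \<times> dyck_tuples k i (n - a))"
  (is "?L = ?R")
proof
  show "?L \<subseteq> ?R"
  proof
    fix x assume "x \<in> ?L"
    then obtain l ls where "x = l # ls" "is_dyck k l" "\<forall>l \<in> set ls. is_dyck k l" "length ls = i"
        "ypos l + sum_list (map ypos ls) = n"
      by (auto simp: dyck_tuples_def length_Suc_conv)
    then show "x \<in> ?R"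
      by (intro image_eqI[of _ _ "(ypos l, l, ls)"]) (auto simp: dyck_tuples_def is_dyck_mem)
  qed
  show "?R \<subseteq> ?L"
    by (auto simp: dyck_tuples_def is_dyck_def) (auto simp: dyck_def)
qed

lemma finite_dyck_tuples: "finite (dyck_tuples k i n)"
proof (induction i arbitrary: n)
  case (Suc i)
  then show ?case unfolding dyck_tuples_Suc
    by (intro finite_imageI finite_SigmaI) (auto simp: finite_dyck)
qed (simp add: dyck_tuples_0)

lemma sum_dyck_tuples_Suc:
  "sum f (dyck_tuples k (Suc i) n)
   = (\<Sum>a\<le>n. \<Sum>l\<in>dyck a k. \<Sum>ls\<in>dyck_tuples k i (n - a). f (l # ls))"
proof -
  have "inj_on (\<lambda>(a, l, ls). l # ls) (SIGMA a:{..n}. dyck a k \<times> dyck_tuples k i (n - a))"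
    by (auto simp: inj_on_def dyck_def)
  then show ?thesis unfolding dyck_tuples_Suc
    by (simp add: sum.reindex sum.Sigma finite_dyck finite_dyck_tuples sum.cartesian_product
        case_prod_unfold)
qed

lemma dyck_Suc:
  "dyck (Suc n) k = (\<lambda>(b, ls, \<mu>). U # join ls @ \<mu>) `
     (SIGMA b:{..n}. dyck_tuples k k b \<times> dyck (n - b) k)"
  (is "?L = ?R")
proof
  show "?L \<subseteq> ?R"
  proof
    fix x assume x: "x \<in> ?L"
    then obtain ls \<mu> where *: "length ls = k" "\<forall>l \<in> set ls. is_dyck k l" "is_dyck k \<mu>"
        "x = U # join ls @ \<mu>"
      using dyck_decomp by blast
    moreover have "ypos (join ls) + ypos \<mu> = n"
      using x * by (auto simp: dyck_def)
    ultimately show "x \<in> ?R"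
      by (intro image_eqI[of _ _ "(ypos (join ls), ls, \<mu>)"])
        (auto simp: dyck_tuples_def is_dyck_mem ypos_join)
  qed
  show "?R \<subseteq> ?L"
  proof
    fix x assume "x \<in> ?R"
    then obtain b ls \<mu> where *: "b \<le> n" "ls \<in> dyck_tuples k k b" "\<mu> \<in> dyck (n - b) k"
        "x = U # join ls @ \<mu>"
      by auto
    then have "is_dyck k \<mu>" by (auto simp: is_dyck_def)
    then have "is_dyck k x"
      using * by (auto simp: dyck_tuples_def intro!: is_dyck_U_join)
    moreover have "ypos x = Suc n"
      using * by (auto simp: dyck_tuples_def dyck_def ypos_join)
    ultimately show "x \<in> ?L" by (simp add: is_dyck_mem)
  qed
qed

lemma sum_dyck_Suc:
  "sum f (dyck (Suc n) k)
   = (\<Sum>b\<le>n. \<Sum>ls\<in>dyck_tuples k k b. \<Sum>\<mu>\<in>dyck (n - b) k. f (U # join ls @ \<mu>))"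
proof -
  have "inj_on (\<lambda>(b, ls, \<mu>). U # join ls @ \<mu>)
          (SIGMA b:{..n}. dyck_tuples k k b \<times> dyck (n - b) k)"
    \<comment> \<open>The inverse drops the \<open>U\<close> and reruns \<open>split_path\<close>;
      the index \<open>b\<close> is recovered as a number of up steps.\<close>
    by (rule inj_on_inverseI[where g =
          "\<lambda>w. case split_path k k (tl w) of (ls, \<mu>) \<Rightarrow> (ypos (join ls), ls, \<mu>)"])
      (auto simp: dyck_tuples_def ypos_join split_path_join)
  then show ?thesis unfolding dyck_Suc
    by (simp add: sum.reindex sum.Sigma finite_dyck finite_dyck_tuples sum.cartesian_product
        case_prod_unfold)
qed

text \<open>\<open>\<mu>\<close> starts on the line at height \<open>Suc b\<close>, so its area is
  unchanged. In doubled height sums the quadratic offset for size \<open>b + c + 1\<close> equals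
  the sum of the offsets of both parts, and only areas remain.\<close>

lemma area_U_join:
  assumes "ls \<in> dyck_tuples k k b" "\<mu> \<in> dyck c k"
  shows "area k (U # join ls @ \<mu>) = join_area k ls + area k \<mu>"
proof -
  have ls: "\<forall>l \<in> set ls. is_dyck k l" "length ls = k" "b = sum_list (map ypos ls)"
    using assms(1) by (auto simp: dyck_tuples_def)
  have c: "ypos \<mu> = c" "xpos \<mu> = k * c" "is_dyck k \<mu>"
    using assms(2) by (auto simp: dyck_def is_dyck_def)
  have "U # join ls @ \<mu> \<in> dyck (Suc (b + c)) k"
    using is_dyck_U_join[OF ls(1,2) c(3)] by (simp add: is_dyck_mem ypos_join c ls)
  from area_dyck[OF this]
  have "2 * area k (U # join ls @ \<mu>) + k * Suc (b + c) * (Suc (b + c) + 1)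
      = 2 * sum_list (down_heights 1 (join ls)) + 2 * sum_list (down_heights 0 \<mu>)
        + 2 * (Suc b * (k * c))"
    using sum_down_heights_shift[of "Suc b" \<mu>]
    by (simp add: down_heights_append ypos_join ls(3)[symmetric] c)
  also have "2 * sum_list (down_heights 1 (join ls))
      = 2 * join_area k ls + k * b * (b + 1) + 2 * k * b + 2 * k"
    using sum_down_heights_join[OF ls(1,3), of 1] ls(2) by simp
  also have "2 * sum_list (down_heights 0 \<mu>) = 2 * area k \<mu> + k * c * (c + 1)"
    using area_dyck[OF assms(2)] by simp
  finally show ?thesis by (simp add: algebra_simps)
qed


section \<open>Generating functions and their functional equation\<close>

text \<open>The contribution of the prime path \<open>U # join ls\<close>, up to the scalar that
  \<open>wt_star\<close> puts in front.\<close>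

definition join_weight :: "nat \<Rightarrow> 'a::comm_ring_1 \<Rightarrow> 'a \<Rightarrow> 'a \<Rightarrow> step list list \<Rightarrow> 'a" where
  "join_weight k m u q ls = (\<Prod>l\<leftarrow>ls. wt_star k m u q l) * q ^ join_area k ls"

definition dyck_fps :: "nat \<Rightarrow> 'a::comm_ring_1 \<Rightarrow> 'a \<Rightarrow> 'a \<Rightarrow> 'a fps" where
  "dyck_fps k m u q = Abs_fps (\<lambda>n. \<Sum>\<mu>\<in>dyck n k. wt_star k m u q \<mu> * q ^ area k \<mu>)"

lemma fps_compose_scale_nth:
  "(F oo (fps_X * fps_const (c :: 'a::comm_ring_1))) $ n = c ^ n * F $ n"
  using fps_compose_linear[of F c] by (simp add: mult.commute)

text \<open>A path put in front of \<open>i\<close> others is lifted by \<open>i + 1\<close>, which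
  rescales the variable of its series by \<open>q ^ (i + 1)\<close>; the lifts of the others do not
  change.\<close>

lemma join_weight_fps:
  "Abs_fps (\<lambda>n. \<Sum>ls\<in>dyck_tuples k i n. join_weight k m u q ls)
   = (\<Prod>j = 1..i. dyck_fps k m u q oo (fps_X * fps_const (q ^ j)))"
proof (induction i)
  case 0
  show ?case
    by (rule fps_ext) (simp add: dyck_tuples_0 join_weight_def)
next
  case (Suc i)
  let ?W = "dyck_fps k m u q" and ?P = "\<lambda>i. Abs_fps (\<lambda>n. \<Sum>ls\<in>dyck_tuples k i n. join_weight k m u q ls)"
  have "?P (Suc i) = (?W oo (fps_X * fps_const (q ^ Suc i))) * ?P i"
  proof (rule fps_ext)
    fix n
    have "(\<Sum>l\<in>dyck a k. \<Sum>ls\<in>dyck_tuples k i b. join_weight k m u q (l # ls))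
        = (?W oo (fps_X * fps_const (q ^ Suc i))) $ a * ?P i $ b" for a b
    proof -
      have "join_weight k m u q (l # ls)
          = (q ^ Suc i) ^ a * (wt_star k m u q l * q ^ area k l) * join_weight k m u q ls"
        if "l \<in> dyck a k" "ls \<in> dyck_tuples k i b" for l ls
      proof -
        have "ypos l = a" "length ls = i" using that by (auto simp: dyck_def dyck_tuples_def)
        moreover have "(q ^ Suc i) ^ a = q ^ (Suc i * a)" by (rule power_mult[symmetric])
        ultimately show ?thesis by (simp add: join_weight_def power_add mult_ac)
      qed
      then show ?thesis
        by (simp add: fps_compose_scale_nth dyck_fps_def sum_distrib_left sum_distrib_right
            cong: sum.cong) (rule sum.swap)
    qed
    then show "?P (Suc i) $ n = ((?W oo (fps_X * fps_const (q ^ Suc i))) * ?P i) $ n"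
      by (simp add: sum_dyck_tuples_Suc fps_mult_nth atMost_atLeast0)
  qed
  then show ?case using Suc by (simp add: mult.commute)
qed

lemma dyck_0: "dyck 0 k = {[]}"
proof -
  have "\<mu> = []" if "xpos \<mu> = 0" "ypos \<mu> = 0" for \<mu>
  proof (cases \<mu>)
    case (Cons s xs)
    then show ?thesis using that by (cases s) auto
  qed
  then show ?thesis by (auto simp: dyck_def)
qed

lemma area_Nil: "area k [] = 0"
  by (simp add: area_def box_below_iff case_prod_unfold) (simp add: box_below_def case_prod_unfold)

text \<open>An empty first path has weight 1, so the products over \<open>ls\<close> and
  \<open>tl ls\<close> then agree and both cases share the term with \<open>q\<close>.\<close>

lemma wt_star_U_join:
  assumes "length ls = k" "\<forall>l \<in> set ls. is_dyck k l" "k \<ge> 1"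
  shows "wt_star k m u q (U # join ls @ \<mu>) =
    (q * (m * (u - 1) + 1) * (\<Prod>l\<leftarrow>ls. wt_star k m u q l)
      + (if hd ls = [] then (m - 1) * (\<Prod>l\<leftarrow>tl ls. wt_star k m u q l) else 0))
    * wt_star k m u q \<mu>"
proof -
  have "(m - 1) * (u - 1) + (u - 1) + 1 = m * (u - 1) + 1" by (simp add: algebra_simps)
  moreover have "ls = hd ls # tl ls" using assms by (cases ls) auto
  then have "(\<Prod>l\<leftarrow>ls. wt_star k m u q l)
      = wt_star k m u q (hd ls) * (\<Prod>l\<leftarrow>tl ls. wt_star k m u q l)"
    by (metis list.simps(9) prod_list.Cons)
  ultimately show ?thesis
    using split_path_join[OF assms(2), of \<mu>] assms(1) by (simp add: Let_def algebra_simps)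
qed

lemma dyck_fps_equation:
  assumes "k \<ge> 1"
  shows "dyck_fps k m u q = 1 + fps_X *
     (fps_const (m - 1) * (\<Prod>j = 0..<k. dyck_fps k m u q oo (fps_X * fps_const (q ^ j)))
      + fps_const (q * (m * (u - 1) + 1)) *
         (\<Prod>j = 0..k. dyck_fps k m u q oo (fps_X * fps_const (q ^ j))))"
proof -
  let ?W = "dyck_fps k m u q" and ?c = "q * (m * (u - 1) + 1)"
  let ?P = "\<lambda>i. Abs_fps (\<lambda>n. \<Sum>ls\<in>dyck_tuples k i n. join_weight k m u q ls)"
  obtain k' where k': "k = Suc k'" using assms by (cases k) auto
  \<comment> \<open>\<open>H\<close> is the series of the first prime factor, its \<open>U\<close>
    not counted in the size; tuples of length \<open>k'\<close> are what follows an empty first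
    path.\<close>
  define H where "H = fps_const (m - 1) * ?P k' + fps_const ?c * ?P k"
  define w where "w ls = ?c * join_weight k m u q ls
      + (if hd ls = [] then (m - 1) * join_weight k m u q (tl ls) else 0)" for ls
  have w: "wt_star k m u q (U # join ls @ \<mu>) * q ^ area k (U # join ls @ \<mu>)
      = w ls * (wt_star k m u q \<mu> * q ^ area k \<mu>)"
    if "ls \<in> dyck_tuples k k b" "\<mu> \<in> dyck a k" for ls \<mu> a b
  proof -
    have "length ls = k" "\<forall>l \<in> set ls. is_dyck k l" using that by (auto simp: dyck_tuples_def)
    \<comment> \<open>An empty path has size 0, so its lift adds no boxes.\<close>
    moreover from this have "join_area k ls = join_area k (tl ls)" if "hd ls = []"
      using that k' by (cases ls) (auto simp: area_Nil)
    ultimately show ?thesis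
      using assms that
      by (simp add: wt_star_U_join area_U_join w_def join_weight_def power_add algebra_simps
          del: wt_star.simps)
  qed
  have sum_w: "(\<Sum>ls\<in>dyck_tuples k k b. w ls) = H $ b" for b
  proof -
    \<comment> \<open>Sorted by the size \<open>a\<close> of the first path, only
      \<open>a = 0\<close> survives.\<close>
    have "(\<Sum>ls\<in>dyck_tuples k k b. if hd ls = [] then (m - 1) * join_weight k m u q (tl ls) else 0)
        = (\<Sum>a\<le>b. if a = 0 then (m - 1) * ?P k' $ b else 0)"
    proof -
      have "(\<Sum>l\<in>dyck a k. \<Sum>ls\<in>dyck_tuples k k' (b - a).
               if l = [] then (m - 1) * join_weight k m u q ls else 0)
          = (if a = 0 then (m - 1) * ?P k' $ b else 0)" for a
      proof (cases "a = 0")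
        case False
        then have "[] \<notin> dyck a k" by (simp add: dyck_def)
        then show ?thesis using False by (auto intro!: sum.neutral)
      qed (simp add: dyck_0 sum_distrib_left)
      moreover have "dyck_tuples k k b = dyck_tuples k (Suc k') b" by (simp add: k')
      ultimately show ?thesis by (simp add: sum_dyck_tuples_Suc cong: if_cong)
    qed
    then show ?thesis
      by (simp add: w_def H_def sum.distrib sum_distrib_left[symmetric] add.commute)
  qed
  have "?W $ Suc n = (H * ?W) $ n" for n
    by (simp add: dyck_fps_def sum_dyck_Suc w fps_mult_nth sum_w[symmetric] sum_product
        atMost_atLeast0 del: wt_star.simps cong: sum.cong)
  moreover have "?W $ 0 = 1" by (simp add: dyck_fps_def dyck_0 area_Nil)
  ultimately have "?W = 1 + fps_X * (H * ?W)"
    by (intro fps_ext) (auto simp: gr0_conv_Suc)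
  \<comment> \<open>The series of the remaining path is the missing factor \<open>j = 0\<close>,
    which extends the ranges \<open>1..k'\<close> and \<open>1..k\<close> to \<open>0..<k\<close>
    and \<open>0..k\<close>.\<close>
  moreover have "?W oo (fps_X * fps_const (q ^ 0)) = ?W"
    by (rule fps_ext) (simp add: fps_compose_scale_nth del: fps_const_1_eq_1)
  moreover have "{0..<k} = insert 0 {1..k'}" "{0..k} = insert 0 {1..k}" using k' by auto
  ultimately show ?thesis
    by (simp add: H_def join_weight_fps algebra_simps del: power_0)
qed

section \<open>Solving the functional equation\<close>

lemma fps_mult_agree:
  assumes "\<And>i. i < n \<Longrightarrow> f $ i = f' $ i" "\<And>i. i < n \<Longrightarrow> g $ i = g' $ i" "i < n"
  shows "(f * g) $ i = (f' * g') $ i"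
  using assms by (auto simp: fps_mult_nth intro!: sum.cong)

lemma fps_prod_agree:
  fixes F G :: "'b \<Rightarrow> 'a::comm_ring_1 fps"
  assumes "\<And>j i. j \<in> J \<Longrightarrow> i < n \<Longrightarrow> F j $ i = G j $ i" "i < n"
  shows "prod F J $ i = prod G J $ i"
  using assms
proof (induction J arbitrary: i rule: infinite_finite_induct)
  case (insert x J)
  then show ?case by (simp, intro fps_mult_agree[of n]) auto
qed auto

text \<open>The equivalence covers existence and uniqueness of the solution. Formal variables are
  the instance where \<open>'a\<close> is a field of rational functions.\<close>

theorem proposition4p9:
  fixes k :: nat and m u q :: "'a::field" and \<chi> :: "'a fps"
  assumes "k \<ge> 1" and "m - 1 \<noteq> 0"
  shows "1 - fps_const (m - 1) * \<chi>
           - fps_X * fps_const q * (\<Prod>j = 0..<k. \<chi> oo (fps_X * fps_const (q ^ j)))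
           - fps_X * fps_const (q\<^sup>2 * (m * (u - 1) + 1)) * (\<Prod>j = 0..k. \<chi> oo (fps_X * fps_const (q ^ j)))
           = 0
         \<longleftrightarrow>
         \<chi> = Abs_fps (\<lambda>n. (- q) ^ n / (m - 1) ^ ((k + 1) * n + 1)
                          * (\<Sum>\<mu> \<in> dyck n k. wt_star k m u q \<mu> * q ^ area k \<mu>))"
    (is "?E \<chi> = 0 \<longleftrightarrow> \<chi> = ?S")
proof -
  define P where "P J \<chi> = (\<Prod>j\<in>J. \<chi> oo (fps_X * fps_const (q ^ j)))" for J and \<chi> :: "'a fps"
  have unique: "\<phi> = \<psi>" if \<phi>: "?E \<phi> = 0" and \<psi>: "?E \<psi> = 0" for \<phi> \<psi>
  proof -
    have "\<phi> $ n = \<psi> $ n" for n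
    proof (induction n rule: less_induct)
      case (less n)
      have P: "P J \<phi> $ i = P J \<psi> $ i" if "i < n" for J i
        unfolding P_def using that less
        by (intro fps_prod_agree[of _ n]) (auto simp: fps_compose_scale_nth)
      \<comment> \<open>Both products carry a factor \<open>fps_X\<close>, so coefficient
        \<open>n\<close> of the right-hand side uses only coefficients of \<open>\<chi>\<close>
        below \<open>n\<close>.\<close>
      have *: "(m - 1) * \<chi> $ n = (1 - fps_X * (fps_const q * P {0..<k} \<chi>)
          - fps_X * (fps_const (q\<^sup>2 * (m * (u - 1) + 1)) * P {0..k} \<chi>)) $ n"
        if "?E \<chi> = 0" for \<chi>
      proof -
        have "fps_const (m - 1) * \<chi> = 1 - fps_X * (fps_const q * P {0..<k} \<chi>)
          - fps_X * (fps_const (q\<^sup>2 * (m * (u - 1) + 1)) * P {0..k} \<chi>)"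
          using that by (simp add: P_def mult.assoc) (simp add: algebra_simps)
        then show ?thesis by (metis fps_mult_left_const_nth)
      qed
      have "(m - 1) * \<phi> $ n = (m - 1) * \<psi> $ n"
        unfolding *[OF \<phi>] *[OF \<psi>] by (cases n) (auto simp: P)
      then show ?case using assms(2) by simp
    qed
    then show ?thesis by (rule fps_ext)
  qed
  have "?E ?S = 0"
  proof -
    let ?W = "dyck_fps k m u q" and ?a = "m - 1"
    \<comment> \<open>The exponent \<open>k + 1\<close> absorbs the \<open>k + 1\<close> factors
      \<open>1 / ?a\<close> that \<open>?S\<close> brings to the longer product; the shorter one
      brings only \<open>k\<close>, which leaves the factor \<open>?a\<close> required there by the
      equation of \<open>?W\<close>.\<close>
    define b where "b = - q / ?a ^ (k + 1)"
    let ?Y = "fps_X * fps_const b"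
    have "b ^ n = (- q) ^ n / ?a ^ ((k + 1) * n)" for n
      unfolding b_def power_divide power_mult ..
    then have S: "?S = fps_const (1 / ?a) * (?W oo ?Y)"
      by (intro fps_ext) (simp add: fps_compose_scale_nth dyck_fps_def)
    \<comment> \<open>Rescalings of the variable commute, so \<open>?Y\<close> can be moved
      outside.\<close>
    have "?S oo (fps_X * fps_const c)
        = fps_const (1 / ?a) * ((?W oo (fps_X * fps_const c)) oo ?Y)" for c
      unfolding S by (rule fps_ext) (simp add: fps_compose_scale_nth)
    then have "P J ?S = (\<Prod>j\<in>J. fps_const (1 / ?a) * ((?W oo (fps_X * fps_const (q ^ j))) oo ?Y))" for J
      unfolding P_def by (intro prod.cong) auto
    then have PS: "P J ?S = fps_const ((1 / ?a) ^ card J) * (P J ?W oo ?Y)" for J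
      by (simp add: P_def prod.distrib fps_compose_prod_distrib fps_const_power)
    have "?W oo ?Y = (1 + fps_X * (fps_const ?a * P {0..<k} ?W
        + fps_const (q * (m * (u - 1) + 1)) * P {0..k} ?W)) oo ?Y"
      using dyck_fps_equation[OF assms(1), of m u q] by (simp add: P_def)
    also have "\<dots> = 1 + ?Y * (fps_const ?a * (P {0..<k} ?W oo ?Y)
        + fps_const (q * (m * (u - 1) + 1)) * (P {0..k} ?W oo ?Y))"
      by (simp add: fps_compose_add_distrib fps_compose_mult_distrib)
    finally have W: "?W oo ?Y = \<dots>" .
    define A B where "A = P {0..<k} ?W oo ?Y" and "B = P {0..k} ?W oo ?Y"
    have aS: "fps_const ?a * ?S = 1 + ?Y * (fps_const ?a * A + fps_const (q * (m * (u - 1) + 1)) * B)"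
      using assms(2) unfolding S W by (simp add: A_def B_def mult.assoc[symmetric])
    \<comment> \<open>Each product in \<open>?E ?S\<close> must cancel one summand of
      \<open>fps_const ?a * ?S\<close>; this reduces the cancellation to a scalar identity, with the
      sign supplied by \<open>b\<close>.\<close>
    have combine: "fps_X * fps_const x * (fps_const y * F) = - (?Y * (fps_const z * F))"
      if "x * y = - (b * z)" for x y z F
    proof -
      have "fps_X * fps_const x * (fps_const y * F) = fps_const (x * y) * (fps_X * F)"
        by (simp flip: fps_const_mult add: mult_ac)
      also have "\<dots> = - (?Y * (fps_const z * F))"
        unfolding that by (simp flip: fps_const_mult fps_const_neg add: mult_ac)
      finally show ?thesis .
    qed
    have X1: "fps_X * fps_const q * P {0..<k} ?S = - (?Y * (fps_const ?a * A))"
      unfolding PS A_def[symmetric] using assms(2)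
      by (intro combine) (simp add: b_def field_simps)
    have X2: "fps_X * fps_const (q\<^sup>2 * (m * (u - 1) + 1)) * P {0..k} ?S
        = - (?Y * (fps_const (q * (m * (u - 1) + 1)) * B))"
      unfolding PS B_def[symmetric] using assms(2)
      by (intro combine) (simp add: b_def power_divide power2_eq_square)
    have "1 - fps_const ?a * ?S - fps_X * fps_const q * P {0..<k} ?S
        - fps_X * fps_const (q\<^sup>2 * (m * (u - 1) + 1)) * P {0..k} ?S = 0"
      unfolding aS X1 X2 by (simp add: algebra_simps)
    then show ?thesis by (simp add: P_def)
  qed
  then show ?thesis using unique by blast
qed

end
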